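(* Let $T$ be a legal-halting Turing machine. Then $\beta^{\omega}$ is fully determined by the output function $\varphi_T$. That is, if $T$ and $T'$ are legal-halting Turing machines with the same state set $Q$, the same tape alphabet $\Gamma$ and the same blank symbol $B$ (hence the same $\Omega$ and the same set of legal words), and if their output functions coincide, $\varphi_T=\varphi_{T'}$ (as partial functions, including equality of their source sets), then $\beta_T^{\omega}=\beta_{T'}^{\omega}$, where $\beta_T,\beta_{T'}$ are the one-move mappings of $T$ and $T'$.
   Context: Turing machines. $T=(Q,A,\Gamma,q_0,F,\delta)$ is a deterministic Turing machine: $Q$ is a finite state set, $A$ a finite input alphabet, $\Gamma\supseteq A\cup\{B\}$ a finite tape alphabet containing the blank symbol $B$, $q_0\in Q$, $F\subseteq Q$, and $\delta:Q\times\Gamma\to Q\times(\Gamma\setminus\{B\})\times\{L,R\}$ is a partial function. Put $\Omega=\Gamma\cup(\Gamma\times Q)$ and write $X^q$ for $(X,q)\in\Gamma\times Q$ ("symbol $X$ with the head on it in state $q$"). $\Omega^*$ is the free monoid, with empty word $1$. Let $\mathrm{tape}:\Omega^*\to\Gamma^*$ and $\mathrm{heads}:\Omega^*\to(\mathbb{N},+)$ be the homomorphisms with $\mathrm{tape}(X)=\mathrm{tape}(X^q)=X$, $\mathrm{heads}(X)=0$, $\mathrm{heads}(X^q)=1$. Legal words: $\mathrm{Leg}(T)=B^*\{w\in\Omega^*\mid \mathrm{tape}(w)\in\{1,B\}(\Gamma\setminus\{B\})^*\{1,B\},\ \mathrm{heads}(w)\le 1\}B^*$. One-move mapping $\beta:\mathrm{Leg}(T)\to\mathrm{Leg}(T)$: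 if $w$ contains no head or the head symbol $X^q$ of $w$ has $\delta(q,X)$ undefined, then $\beta(w)=w$. If $w=uX^qZv$ with $\delta(q,X)=(p,Y,R)$ and $Z\in\Gamma$, then $\beta(w)=uYZ^pv$; if $w=uZX^qv$ with $\delta(q,X)=(p,Y,L)$ and $Z\in\Gamma$, then $\beta(w)=uZ^pYv$. If $w=X^qw'$ with $\delta(q,X)=(p,Y,L)$ then $\beta(w):=\beta(Bw)=B^pYw'$; if $w=w'X^q$ with $\delta(q,X)=(p,Y,R)$ then $\beta(w):=\beta(wB)=w'YB^p$. $\beta^n$ is the $n$-fold composition. For $u,v\in\Omega^*$, $X\in\Omega$ and $n\ge 0$: if $uXv\in\mathrm{Leg}(T)$, then $\beta^{(n)}(u,X,v)\in\Omega$ is the symbol found, after applying $\beta$ $n$ times to $uXv$, in the tape cell originally occupied by the distinguished letter $X$ (cells may be added at either end of the word, but the designated cell stays fixed); if $uXv\notin\mathrm{Leg}(T)$, it is undefined. $T$ is legal-halting if for every $u\in\mathrm{Leg}(T)$ the sequence $(\beta^n(u))_n$ is eventually constant; then $\beta^{\omega}(u)=\lim_{n\to\infty}\beta^n(u)$ for $u\in\mathrm{Leg}(T)$ and $\beta^{(\omega)}(u,X,v)=\lim_{n\to\infty}\beta^{(n)}(u,X,v)$ whenever $uXv\in\mathrm{Leg}(T)$ (undefined otherwise). Resets: $r\in\Omega^*$ is a right reset if $\beta^{(n)}(t_1rt_2,X,t_3)=\beta^{(n)}(t_1'rt_2,X,t_3)$ for all $t_1,t_1',t_2,t_3\in\Omega^*$,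 $X\in\Omega$, $n\ge0$ such that both $t_1rt_2Xt_3$ and $t_1'rt_2Xt_3$ are in $\mathrm{Leg}(T)$. $r$ is a left reset if $\beta^{(n)}(t_1,X,t_2rt_3)=\beta^{(n)}(t_1,X,t_2rt_3')$ for all $t_1,t_2,t_3,t_3'\in\Omega^*$, $X\in\Omega$, $n\ge 0$ such that both $t_1Xt_2rt_3$ and $t_1Xt_2rt_3'$ are in $\mathrm{Leg}(T)$. $\mathrm{RRes}(T)$, $\mathrm{LRes}(T)$ denote the sets of right, left resets. $\mathrm{RSC}(T)$ is the set of elements of $\mathrm{RRes}(T)$ that are minimal for the suffix order ($u\le_s v$ iff $v\in\Omega^*u$); $\mathrm{LSC}(T)$ is the set of elements of $\mathrm{LRes}(T)$ that are minimal for the prefix order ($u\le_p v$ iff $v\in u\Omega^*$). The output function $\varphi_T$ is the restriction of the partial function $\beta^{(\omega)}:\Omega^*\times\Omega\times\Omega^*\to\Omega$ to $(\mathrm{RSC}(T)\cup\{1\})\times\Omega\times(\mathrm{LSC}(T)\cup\{1\})$. *)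

theory Defs
  imports Complex_Main "HOL-Library.Sublist"
begin

datatype direction = Left | Right

record ('q, 'g) tm =
  states :: "'q set"
  input_alphabet :: "'g set"
  tape_alphabet :: "'g set"
  blank :: 'g
  start :: 'q
  final :: "'q set"
  delta :: "'q \<times> 'g \<rightharpoonup> 'q \<times> 'g \<times> direction"

definition turing_machine :: "('q, 'g) tm \<Rightarrow> bool" where
  "turing_machine T \<longleftrightarrow>
     finite (states T) \<and> finite (input_alphabet T) \<and> finite (tape_alphabet T) \<and>
     input_alphabet T \<union> {blank T} \<subseteq> tape_alphabet T \<and>
     start T \<in> states T \<and> final T \<subseteq> states T \<and>
     dom (delta T) \<subseteq> states T \<times> tape_alphabet T \<and>
     ran (delta T) \<subseteq> states T \<times> (tape_alphabet T - {blank T}) \<times> UNIV"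


text \<open>The letters of \<open>\<Omega> = \<Gamma> \<union> (\<Gamma> \<times> Q)\<close>: \<open>Cell X\<close> is \<open>X\<close>, and \<open>Head X q\<close> is \<open>X\<^sup>q\<close>.
  Words are lists.\<close>

datatype ('q, 'g) letter =
    is_cell: Cell (symb: 'g)
  | is_head: Head (symb: 'g) (head_state: 'q)

type_synonym ('q, 'g) word = "('q, 'g) letter list"

definition Omega :: "('q, 'g) tm \<Rightarrow> ('q, 'g) letter set" where
  "Omega T = {Cell X |X. X \<in> tape_alphabet T}
     \<union> {Head X q |X q. X \<in> tape_alphabet T \<and> q \<in> states T}"

definition tape :: "('q, 'g) word \<Rightarrow> 'g list" where
  "tape w = map symb w"

definition heads :: "('q, 'g) word \<Rightarrow> nat" where
  "heads w = length (filter is_head w)"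

definition Leg :: "('q, 'g) tm \<Rightarrow> ('q, 'g) word set" where
  "Leg T = {replicate i (Cell (blank T)) @ w @ replicate j (Cell (blank T)) |i w j.
     w \<in> lists (Omega T) \<and>
     tape w \<in> {a @ x @ b |a x b. a \<in> {[], [blank T]} \<and>
                 x \<in> lists (tape_alphabet T - {blank T}) \<and> b \<in> {[], [blank T]}} \<and>
     heads w \<le> 1}"


text \<open>The one-move mapping acts at the first head of the word. It is a total function here, but
  is meaningful only on legal words, where that head is the only one, so that the neighbouring
  letter \<open>Z\<close> is always a \<open>Cell\<close>.\<close>

definition beta :: "('q, 'g) tm \<Rightarrow> ('q, 'g) word \<Rightarrow> ('q, 'g) word" where
  "beta T w = (let u = takeWhile is_cell w in
     case dropWhile is_cell w of
       Head X q # v \<Rightarrow>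
         (case delta T (q, X) of
            None \<Rightarrow> w
          | Some (p, Y, Right) \<Rightarrow>
              (case v of
                 [] \<Rightarrow> u @ [Cell Y, Head (blank T) p]
               | Z # v' \<Rightarrow> u @ [Cell Y, Head (symb Z) p] @ v')
          | Some (p, Y, Left) \<Rightarrow>
              (if u = [] then [Head (blank T) p, Cell Y] @ v
               else butlast u @ [Head (symb (last u)) p, Cell Y] @ v))
     | _ \<Rightarrow> w)"

lemma heads_simps [simp]:
  "heads [] = 0" "heads (Cell X # w) = heads w" "heads (Head X q # w) = Suc (heads w)"
  "heads (u @ v) = heads u + heads v"
  by (simp_all add: heads_def)

lemma heads_eq_0_iff: "heads w = 0 \<longleftrightarrow> (\<forall>x\<in>set w. is_cell x)"
proof (induction w)
  case (Cons a w)
  then show ?case by (cases a) simp_all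
qed simp

lemma takeWhile_dropWhile_Head:
  assumes "heads u = 0"
  shows "takeWhile is_cell (u @ Head X q # v) = u"
    and "dropWhile is_cell (u @ Head X q # v) = Head X q # v"
  using assms by (auto simp: heads_eq_0_iff takeWhile_append2 dropWhile_append2)

lemma beta_no_head: "heads w = 0 \<Longrightarrow> beta T w = w"
  by (simp add: beta_def heads_eq_0_iff dropWhile_eq_Nil_conv[THEN iffD2])

lemma beta_undefined:
  "\<lbrakk>heads u = 0; delta T (q, X) = None\<rbrakk> \<Longrightarrow> beta T (u @ [Head X q] @ v) = u @ [Head X q] @ v"
  by (simp add: beta_def takeWhile_dropWhile_Head)

lemma beta_right:
  "\<lbrakk>heads u = 0; delta T (q, X) = Some (p, Y, Right)\<rbrakk>
    \<Longrightarrow> beta T (u @ [Head X q, Cell Z] @ v) = u @ [Cell Y, Head Z p] @ v"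
  by (simp add: beta_def takeWhile_dropWhile_Head)

lemma beta_left:
  assumes "heads u = 0" "delta T (q, X) = Some (p, Y, Left)"
  shows "beta T (u @ [Cell Z, Head X q] @ v) = u @ [Head Z p, Cell Y] @ v"
  using takeWhile_dropWhile_Head[of "u @ [Cell Z]" X q v] assms
  by (simp add: beta_def)

lemma beta_left_end:
  "delta T (q, X) = Some (p, Y, Left)
    \<Longrightarrow> beta T ([Head X q] @ w) = [Head (blank T) p, Cell Y] @ w"
  by (simp add: beta_def)

lemma beta_right_end:
  "\<lbrakk>heads w = 0; delta T (q, X) = Some (p, Y, Right)\<rbrakk>
    \<Longrightarrow> beta T (w @ [Head X q]) = w @ [Cell Y, Head (blank T) p]"
  by (simp add: beta_def takeWhile_dropWhile_Head)


text \<open>A move adds a cell at the left end, thereby shifting the position of every existing cell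
  by one, exactly when the head leaves the word on the left.\<close>

definition adds_left :: "('q, 'g) tm \<Rightarrow> ('q, 'g) word \<Rightarrow> bool" where
  "adds_left T w \<longleftrightarrow> (\<exists>X q w' p Y. w = Head X q # w' \<and> delta T (q, X) = Some (p, Y, Left))"

definition left_shift :: "('q, 'g) tm \<Rightarrow> nat \<Rightarrow> ('q, 'g) word \<Rightarrow> nat" where
  "left_shift T n w = (\<Sum>k<n. if adds_left T ((beta T ^^ k) w) then 1 else 0)"

text \<open>\<open>cell_beta T n (u, X, v)\<close> is \<open>\<beta>\<^bsup>(n)\<^esup>(u, X, v)\<close>.\<close>

definition cell_beta :: "('q, 'g) tm \<Rightarrow> nat \<Rightarrow>
    ('q, 'g) word \<times> ('q, 'g) letter \<times> ('q, 'g) word \<rightharpoonup> ('q, 'g) letter" where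
  "cell_beta T n = (\<lambda>(u, X, v).
     let w = u @ [X] @ v in
     if w \<in> Leg T then Some ((beta T ^^ n) w ! (length u + left_shift T n w)) else None)"


text \<open>The limit of an eventually constant sequence, i.e. its limit in the discrete topology.\<close>

definition eventual_value :: "(nat \<Rightarrow> 'a) \<Rightarrow> 'a" where
  "eventual_value f = (THE x. \<forall>\<^sub>F n in sequentially. f n = x)"

definition legal_halting :: "('q, 'g) tm \<Rightarrow> bool" where
  "legal_halting T \<longleftrightarrow>
     (\<forall>w \<in> Leg T. \<exists>x. \<forall>\<^sub>F n in sequentially. (beta T ^^ n) w = x)"

definition beta_omega :: "('q, 'g) tm \<Rightarrow> ('q, 'g) word \<Rightarrow> ('q, 'g) word" where
  "beta_omega T w = eventual_value (\<lambda>n. (beta T ^^ n) w)"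

definition cell_beta_omega :: "('q, 'g) tm \<Rightarrow>
    ('q, 'g) word \<times> ('q, 'g) letter \<times> ('q, 'g) word \<rightharpoonup> ('q, 'g) letter" where
  "cell_beta_omega T = (\<lambda>(u, X, v).
     if u @ [X] @ v \<in> Leg T then eventual_value (\<lambda>n. cell_beta T n (u, X, v)) else None)"


definition RRes :: "('q, 'g) tm \<Rightarrow> ('q, 'g) word set" where
  "RRes T = {r \<in> lists (Omega T).
     \<forall>t1 \<in> lists (Omega T). \<forall>t1' \<in> lists (Omega T). \<forall>t2 \<in> lists (Omega T).
     \<forall>t3 \<in> lists (Omega T). \<forall>X \<in> Omega T. \<forall>n.
       t1 @ r @ t2 @ [X] @ t3 \<in> Leg T \<longrightarrow> t1' @ r @ t2 @ [X] @ t3 \<in> Leg T \<longrightarrow>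
       cell_beta T n (t1 @ r @ t2, X, t3) = cell_beta T n (t1' @ r @ t2, X, t3)}"

definition LRes :: "('q, 'g) tm \<Rightarrow> ('q, 'g) word set" where
  "LRes T = {r \<in> lists (Omega T).
     \<forall>t1 \<in> lists (Omega T). \<forall>t2 \<in> lists (Omega T). \<forall>t3 \<in> lists (Omega T).
     \<forall>t3' \<in> lists (Omega T). \<forall>X \<in> Omega T. \<forall>n.
       t1 @ [X] @ t2 @ r @ t3 \<in> Leg T \<longrightarrow> t1 @ [X] @ t2 @ r @ t3' \<in> Leg T \<longrightarrow>
       cell_beta T n (t1, X, t2 @ r @ t3) = cell_beta T n (t1, X, t2 @ r @ t3')}"

definition RSC :: "('q, 'g) tm \<Rightarrow> ('q, 'g) word set" where
  "RSC T = {r \<in> RRes T. \<forall>s \<in> RRes T. suffix s r \<longrightarrow> s = r}"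

definition LSC :: "('q, 'g) tm \<Rightarrow> ('q, 'g) word set" where
  "LSC T = {r \<in> LRes T. \<forall>s \<in> LRes T. prefix s r \<longrightarrow> s = r}"

definition output_source :: "('q, 'g) tm \<Rightarrow>
    (('q, 'g) word \<times> ('q, 'g) letter \<times> ('q, 'g) word) set" where
  "output_source T = (RSC T \<union> {[]}) \<times> Omega T \<times> (LSC T \<union> {[]})"

text \<open>The output function is a partial function with a designated source set, which is in general
  larger than its domain of definition; it is therefore represented by the source set together
  with the map.\<close>

definition output_function :: "('q, 'g) tm \<Rightarrow>
    (('q, 'g) word \<times> ('q, 'g) letter \<times> ('q, 'g) word) set \<times>
    (('q, 'g) word \<times> ('q, 'g) letter \<times> ('q, 'g) word \<rightharpoonup> ('q, 'g) letter)" where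
  "output_function T = (output_source T, cell_beta_omega T |` output_source T)"

end

theory Submission
  imports Defs
begin

text \<open>
  Padding a legal word \<open>w\<close> with blanks changes neither the moves of the machine nor the symbols in
  the cells of \<open>w\<close>. After padding on both sides, every cell splits the word as \<open>u X v\<close> where \<open>u\<close>
  consists of blanks or is a blank followed by something else. In the first case \<open>u\<close> can be dropped.
  In the second case \<open>u\<close> is a right reset of every machine, because a legal word has only blanks
  to the left of such a factor; hence \<open>u\<close> can be replaced by a suffix in \<open>RSC T\<close>. With the mirror
  image for \<open>v\<close>, the final content of each cell is a value of the output function. These contents
  determine \<open>\<beta>\<^sup>\<omega>(w)\<close>, since a cell added during the run is never left as a plain blank.
\<close>

section \<open>The machine as a cellular automaton on a bi-infinite tape\<close>

text \<open>This is the signal that a letter sends to its neighbour on side \<open>d\<close>: the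
  state in which a head enters there, or \<open>None\<close>.\<close>

definition exit_state :: "('q, 'g) tm \<Rightarrow> direction \<Rightarrow> ('q, 'g) letter \<Rightarrow> 'q option" where
  "exit_state T d x = (case x of Cell _ \<Rightarrow> None
     | Head X q \<Rightarrow> (case delta T (q, X) of None \<Rightarrow> None
         | Some (p, Y, e) \<Rightarrow> if e = d then Some p else None))"

text \<open>A head arriving from the left takes precedence over one from the right; with at most one
  head on the tape the two never compete.\<close>

definition local_rule ::
    "('q, 'g) tm \<Rightarrow> ('q, 'g) letter \<Rightarrow> ('q, 'g) letter \<Rightarrow> ('q, 'g) letter \<Rightarrow> ('q, 'g) letter" where
  "local_rule T l x r = (case x of
       Head X q \<Rightarrow> (case delta T (q, X) of None \<Rightarrow> x | Some (p, Y, d) \<Rightarrow> Cell Y)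
     | Cell X \<Rightarrow> (case exit_state T Right l of Some p \<Rightarrow> Head X p
         | None \<Rightarrow> (case exit_state T Left r of Some p \<Rightarrow> Head X p | None \<Rightarrow> Cell X)))"

text \<open>On a tape without ends a move needs no border cases, and cells keep their positions,
  whereas \<open>beta\<close> renumbers them whenever it adds a cell on the left.\<close>

definition step :: "('q, 'g) tm \<Rightarrow> (int \<Rightarrow> ('q, 'g) letter) \<Rightarrow> int \<Rightarrow> ('q, 'g) letter" where
  "step T c = (\<lambda>j. local_rule T (c (j - 1)) (c j) (c (j + 1)))"

text \<open>The cell at position \<open>0\<close> of \<open>conf b k w\<close> holds the letter of \<open>w\<close> with index \<open>k\<close>, so \<open>k\<close> is the
  number of cells that were added on the left.\<close>

definition conf :: "'g \<Rightarrow> int \<Rightarrow> ('q, 'g) word \<Rightarrow> int \<Rightarrow> ('q, 'g) letter" where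
  "conf b k w = (\<lambda>j. if 0 \<le> j + k \<and> j + k < int (length w) then w ! nat (j + k) else Cell b)"

lemma exit_state_Cell [simp]: "exit_state T d (Cell X) = None"
  by (simp add: exit_state_def)

lemma step_all_cells:
  assumes "\<And>j. is_cell (c j)"
  shows "step T c = c"
proof
  fix j
  \<comment> \<open>Once \<open>c\<close> is visibly a composition with \<open>Cell\<close>, simp
    can evaluate every case distinction of \<open>local_rule\<close>.\<close>
  obtain f where "c = (\<lambda>j. Cell (f j))"
    using that[of "\<lambda>j. symb (c j)"] assms by simp
  then show "step T c j = c j"
    by (simp add: step_def local_rule_def)
qed

lemma step_undefined:
  assumes "\<And>j. is_cell (c j)" "delta T (q, X) = None"
  shows "step T (c(i := Head X q)) = c(i := Head X q)"
proof
  fix j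
  obtain f where "c = (\<lambda>j. Cell (f j))"
    using that[of "\<lambda>j. symb (c j)"] assms by simp
  then show "step T (c(i := Head X q)) j = (c(i := Head X q)) j"
    using assms(2) by (simp add: step_def local_rule_def exit_state_def)
qed

lemma step_right:
  assumes "\<And>j. is_cell (c j)" "delta T (q, X) = Some (p, Y, Right)"
  shows "step T (c(i := Head X q)) = c(i := Cell Y, i + 1 := Head (symb (c (i + 1))) p)"
proof
  fix j
  obtain f where "c = (\<lambda>j. Cell (f j))"
    using that[of "\<lambda>j. symb (c j)"] assms by simp
  then show "step T (c(i := Head X q)) j = (c(i := Cell Y, i + 1 := Head (symb (c (i + 1))) p)) j"
    using assms(2) by (auto simp: step_def local_rule_def exit_state_def)
qed

lemma step_left:
  assumes "\<And>j. is_cell (c j)" "delta T (q, X) = Some (p, Y, Left)"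
  shows "step T (c(i := Head X q)) = c(i := Cell Y, i - 1 := Head (symb (c (i - 1))) p)"
proof
  fix j
  obtain f where "c = (\<lambda>j. Cell (f j))"
    using that[of "\<lambda>j. symb (c j)"] assms by simp
  then show "step T (c(i := Head X q)) j = (c(i := Cell Y, i - 1 := Head (symb (c (i - 1))) p)) j"
    using assms(2) by (auto simp: step_def local_rule_def exit_state_def)
qed

text \<open>The local rule is the same at every position, so the automaton commutes with
  translations. This absorbs the renumbering caused by padding on the left.\<close>

lemma step_shift: "(step T ^^ n) (\<lambda>j. c (j + k)) = (\<lambda>j. (step T ^^ n) c (j + k))"
proof (induction n)
  case (Suc n)
  show ?case
  proof
    fix j
    have "j - 1 + k = j + k - 1" "j + 1 + k = j + k + 1" by simp_all
    then show "(step T ^^ Suc n) (\<lambda>j. c (j + k)) j = (step T ^^ Suc n) c (j + k)"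
      unfolding funpow.simps o_apply Suc by (simp only: step_def)
  qed
qed simp

text \<open>A departing head writes a symbol other than the blank, and a plain cell either keeps its
  symbol or receives a head. Hence no step creates a plain blank.\<close>

lemma step_not_blank:
  assumes "turing_machine T" "c j \<noteq> Cell (blank T)"
  shows "step T c j \<noteq> Cell (blank T)"
proof -
  have "Y \<noteq> blank T" if "delta T z = Some (p, Y, d)" for z p Y d
    using assms(1) that by (force simp: turing_machine_def ran_def)
  then show ?thesis
    using assms(2)
    by (auto simp: step_def local_rule_def split: letter.splits option.splits prod.splits)
qed

section \<open>Finite words as configurations\<close>

lemma conf_update:
  "conf b k (u @ x # v) = (conf b k (u @ y # v))(int (length u) - k := x)"
  by (rule ext) (auto simp: conf_def nth_append nth_Cons')

lemma conf_snoc_blank: "conf b k (w @ [Cell b]) = conf b k w"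
  by (rule ext) (auto simp: conf_def nth_append)

lemma conf_Cons_blank: "conf b (k + 1) (Cell b # w) = conf b k w"
  by (rule ext) (auto simp: conf_def nth_Cons' nat_diff_distrib' algebra_simps intro!: arg_cong[of _ _ "(!) w"])

text \<open>\<open>conf\<close> already supplies blanks outside the word; those prepended explicitly
  are compensated by raising the offset.\<close>

lemma conf_pad:
  "conf b (k + int m) (replicate m (Cell b) @ w @ replicate n (Cell b)) = conf b k w"
proof -
  have "conf b k (w @ replicate n (Cell b)) = conf b k w"
  proof (induction n)
    case (Suc n)
    have "w @ replicate (Suc n) (Cell b) = (w @ replicate n (Cell b)) @ [Cell b]"
      by (simp add: replicate_append_same)
    with Suc show ?case by (simp only: conf_snoc_blank)
  qed simp
  moreover have "conf b (k + int m) (replicate m (Cell b) @ v) = conf b k v" for v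
  proof (induction m)
    case (Suc m)
    have "k + int (Suc m) = k + int m + 1" by simp
    with Suc show ?case by (simp only: replicate_Suc append_Cons conf_Cons_blank)
  qed simp
  ultimately show ?thesis by metis
qed

lemma conf_is_cell: "heads w = 0 \<Longrightarrow> is_cell (conf b k w j)"
  by (auto simp: conf_def heads_eq_0_iff)

lemma conf_nth: "i < length w \<Longrightarrow> conf b k w (int i - k) = w ! i"
  by (simp add: conf_def)

section \<open>Moves of \<open>beta\<close> as steps of the automaton\<close>

lemma one_head_cases:
  assumes "heads w \<le> 1"
  obtains (none) "heads w = 0"
  | (one) u X q v where "w = u @ Head X q # v" "heads u = 0" "heads v = 0"
proof (cases "heads w = 0")
  case False
  then obtain x where "x \<in> set w" "\<not> is_cell x"
    by (auto simp: heads_eq_0_iff)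
  then obtain X q where "Head X q \<in> set w" by (metis letter.exhaust letter.disc(1))
  then obtain u v where "w = u @ Head X q # v" by (auto simp: in_set_conv_decomp)
  with assms show ?thesis by (intro one[of u X q v]) auto
qed

lemma adds_left_iff:
  assumes "heads u = 0"
  shows "adds_left T (u @ Head X q # v) \<longleftrightarrow> u = [] \<and> (\<exists>p Y. delta T (q, X) = Some (p, Y, Left))"
proof (cases u)
  case (Cons z u')
  then show ?thesis using assms by (cases z) (simp_all add: adds_left_def)
qed (simp add: adds_left_def)

text \<open>A case analysis on the head, its move and whether it stands at an end of the word. The
  last two claims record that a newly added cell carries the head, which later shows that it never
  becomes a plain blank.\<close>

lemma beta_step:
  fixes T :: "('q, 'g) tm"
  assumes "heads w \<le> 1"
  shows "heads (beta T w) \<le> 1"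
    and "conf (blank T) (k + (if adds_left T w then 1 else 0)) (beta T w) = step T (conf (blank T) k w)"
    and "length (beta T w) = length w \<and> \<not> adds_left T w \<or> length (beta T w) = Suc (length w)"
    and "adds_left T w \<Longrightarrow> is_head (hd (beta T w))"
    and "length (beta T w) > length w \<Longrightarrow> \<not> adds_left T w \<Longrightarrow> is_head (last (beta T w))"
proof -
  let ?b = "blank T"
  let ?P = "\<lambda>w'. heads w' \<le> 1 \<and>
    conf ?b (k + (if adds_left T w then 1 else 0)) w' = step T (conf ?b k w) \<and>
    (length w' = length w \<and> \<not> adds_left T w \<or> length w' = Suc (length w)) \<and>
    (adds_left T w \<longrightarrow> is_head (hd w')) \<and>
    (length w' > length w \<longrightarrow> \<not> adds_left T w \<longrightarrow> is_head (last w'))"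
  have "?P (beta T w)"
    using assms
  proof (cases rule: one_head_cases)
    case none
    then have "\<not> adds_left T w" by (auto simp: adds_left_def)
    with none show ?thesis by (simp add: beta_no_head step_all_cells conf_is_cell)
  next
    case (one u X q v)
    \<comment> \<open>\<open>?c\<close> is the configuration with the head removed, and
      \<open>?i\<close> is the position of the head. Both sides of the claim are computed as updates
      of \<open>?c\<close>.\<close>
    let ?c = "conf ?b k (u @ Cell X # v)" and ?i = "int (length u) - k"
    have cells: "is_cell (?c j)" for j using one by (simp add: conf_is_cell)
    have cw: "conf ?b k w = ?c(?i := Head X q)"
      unfolding one(1) by (rule conf_update)
    show ?thesis
    proof (cases "delta T (q, X)")
      case None
      then have "beta T w = w" using beta_undefined[of u T q X v] one by simp
      moreover have "\<not> adds_left T w"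
        using one None by (simp add: adds_left_iff)
      ultimately show ?thesis
        using assms by (simp add: cw step_undefined[of ?c, OF cells None])
    next
      case (Some a)
      then obtain p Y d where d: "delta T (q, X) = Some (p, Y, d)" by (cases a) auto
      show ?thesis
      proof (cases d)
        case Right
        have na: "\<not> adds_left T w"
          using one d Right by (simp add: adds_left_iff)
        have st: "step T (conf ?b k w) = ?c(?i := Cell Y, ?i + 1 := Head (symb (?c (?i + 1))) p)"
          unfolding cw using step_right[of ?c, OF cells] d Right by blast
        show ?thesis
        proof (cases v)
          case Nil
          have bw: "beta T w = u @ [Cell Y, Head ?b p]"
            using beta_right_end[of u T q X p Y] one Nil d Right by simp
          \<comment> \<open>The new cell lies just beyond the word, where \<open>conf\<close> has
            its default blank; a blank may therefore be appended first and then overwritten by the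
            head.\<close>
          have "conf ?b k (u @ [Cell Y, Head ?b p])
              = (conf ?b k (u @ [Cell Y, Cell ?b]))(?i + 1 := Head ?b p)"
            using conf_update[of ?b k "u @ [Cell Y]" "Head ?b p" "[]" "Cell ?b"]
            by (simp add: algebra_simps)
          also have "conf ?b k (u @ [Cell Y, Cell ?b]) = conf ?b k (u @ [Cell Y])"
            using conf_snoc_blank[of ?b k "u @ [Cell Y]"] by simp
          also have "\<dots> = ?c(?i := Cell Y)" unfolding Nil by (rule conf_update)
          finally have "conf ?b k (beta T w) = ?c(?i := Cell Y, ?i + 1 := Head ?b p)"
            unfolding bw .
          moreover have "symb (?c (?i + 1)) = ?b" by (simp add: conf_def Nil)
          ultimately have "conf ?b k (beta T w) = step T (conf ?b k w)"
            unfolding st by (simp only:)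
          with bw one Nil na show ?thesis by simp
        next
          case (Cons z v')
          then obtain Z where z: "z = Cell Z" using one by (cases z) auto
          have bw: "beta T w = u @ [Cell Y, Head Z p] @ v'"
            using beta_right[of u T q X p Y Z v'] one Cons z d Right by simp
          have "conf ?b k (u @ [Cell Y, Head Z p] @ v')
              = (conf ?b k (u @ Cell Y # v))(?i + 1 := Head Z p)"
            using conf_update[of ?b k "u @ [Cell Y]" "Head Z p" v' z]
            by (simp add: algebra_simps Cons)
          also have "conf ?b k (u @ Cell Y # v) = ?c(?i := Cell Y)" by (rule conf_update)
          finally have "conf ?b k (beta T w) = ?c(?i := Cell Y, ?i + 1 := Head Z p)"
            unfolding bw .
          moreover have "symb (?c (?i + 1)) = Z"
            by (simp add: conf_def Cons z nth_append nat_add_distrib)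
          ultimately have "conf ?b k (beta T w) = step T (conf ?b k w)"
            unfolding st by (simp only:)
          with bw one Cons z na show ?thesis by simp
        qed
      next
        case Left
        have st: "step T (conf ?b k w) = ?c(?i := Cell Y, ?i - 1 := Head (symb (?c (?i - 1))) p)"
          unfolding cw using step_left[of ?c, OF cells] d Left by blast
        show ?thesis
        proof (cases u rule: rev_cases)
          case Nil
          have al: "adds_left T w" using one d Left Nil by (simp add: adds_left_def)
          have bw: "beta T w = [Head ?b p, Cell Y] @ v"
            using beta_left_end[of T q X p Y v] one Nil d Left by simp
          \<comment> \<open>The offset \<open>k + 1\<close> cancels the renumbering: position
            \<open>?i - 1\<close> now has index 0 and was a default blank before the move.\<close>
          have "conf ?b (k + 1) (beta T w)
              = (conf ?b (k + 1) (Cell ?b # Cell Y # v))(?i - 1 := Head ?b p)"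
            using conf_update[of ?b "k + 1" "[]" "Head ?b p" "Cell Y # v" "Cell ?b"]
            by (simp add: bw Nil)
          also have "conf ?b (k + 1) (Cell ?b # Cell Y # v) = conf ?b k (Cell Y # v)"
            by (rule conf_Cons_blank)
          also have "\<dots> = ?c(?i := Cell Y)"
            using conf_update[of ?b k u "Cell Y" v "Cell X"] by (simp add: Nil)
          finally have "conf ?b (k + 1) (beta T w) = ?c(?i := Cell Y, ?i - 1 := Head ?b p)" .
          moreover have "symb (?c (?i - 1)) = ?b" by (simp add: conf_def Nil)
          ultimately have "conf ?b (k + 1) (beta T w) = step T (conf ?b k w)"
            unfolding st by (simp only:)
          with bw one Nil al show ?thesis by simp
        next
          case (snoc u' z)
          then obtain Z where z: "z = Cell Z" using one by (cases z) auto
          have na: "\<not> adds_left T w"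
            unfolding one(1) using one(2) snoc by (subst adds_left_iff) simp_all
          have bw: "beta T w = u' @ [Head Z p, Cell Y] @ v"
            using beta_left[of u' T q X p Y Z v] one snoc z d Left by simp
          have "conf ?b k (beta T w) = (conf ?b k (u @ Cell Y # v))(?i - 1 := Head Z p)"
            using conf_update[of ?b k "u'" "Head Z p" "Cell Y # v" z]
            by (simp add: algebra_simps snoc bw)
          also have "conf ?b k (u @ Cell Y # v) = ?c(?i := Cell Y)" by (rule conf_update)
          finally have "conf ?b k (beta T w) = ?c(?i := Cell Y, ?i - 1 := Head Z p)" .
          moreover have "symb (?c (?i - 1)) = Z" by (simp add: conf_def snoc z nth_append)
          ultimately have "conf ?b k (beta T w) = step T (conf ?b k w)"
            unfolding st by (simp only:)
          with bw one snoc z na show ?thesis by simp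
        qed
      qed
    qed
  qed
  then show "heads (beta T w) \<le> 1"
    and "conf ?b (k + (if adds_left T w then 1 else 0)) (beta T w) = step T (conf ?b k w)"
    and "length (beta T w) = length w \<and> \<not> adds_left T w \<or> length (beta T w) = Suc (length w)"
    and "adds_left T w \<Longrightarrow> is_head (hd (beta T w))"
    and "length (beta T w) > length w \<Longrightarrow> \<not> adds_left T w \<Longrightarrow> is_head (last (beta T w))"
    by blast+
qed


lemma left_shift_Suc:
  "left_shift T (Suc n) w = left_shift T n w + (if adds_left T ((beta T ^^ n) w) then 1 else 0)"
  by (simp add: left_shift_def)

text \<open>Induction with \<open>beta_step\<close>. The last two claims say that an outermost added
  cell is not a plain blank: it carried the head when it was added, and
  \<open>step_not_blank\<close> preserves this. So the configuration determines the ends of the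
  word.\<close>

lemma run_conf:
  assumes "turing_machine T" "heads w \<le> 1"
  defines "wn \<equiv> \<lambda>n. (beta T ^^ n) w" and "L \<equiv> \<lambda>n. left_shift T n w"
    and "c \<equiv> \<lambda>n. (step T ^^ n) (conf (blank T) 0 w)"
  shows "heads (wn n) \<le> 1"
    and "conf (blank T) (int (L n)) (wn n) = c n"
    and "length w + L n \<le> length (wn n)"
    and "L n > 0 \<Longrightarrow> c n (- int (L n)) \<noteq> Cell (blank T)"
    and "length w + L n < length (wn n) \<Longrightarrow>
      c n (int (length (wn n)) - int (L n) - 1) \<noteq> Cell (blank T)"
proof -
  let ?b = "blank T"
  have "heads (wn n) \<le> 1 \<and> conf ?b (int (L n)) (wn n) = c n \<and> length w + L n \<le> length (wn n) \<and>
    (L n > 0 \<longrightarrow> c n (- int (L n)) \<noteq> Cell ?b) \<and>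
    (length w + L n < length (wn n) \<longrightarrow> c n (int (length (wn n)) - int (L n) - 1) \<noteq> Cell ?b)"
  proof (induction n)
    case 0
    then show ?case using assms(2) by (simp add: wn_def L_def c_def left_shift_def)
  next
    case (Suc n)
    let ?a = "adds_left T (wn n)"
    have h: "heads (wn n) \<le> 1" using Suc by simp
    note bs = beta_step(1,3-)[OF h, of T] beta_step(2)[OF h, of T "int (L n)"]
    have w': "wn (Suc n) = beta T (wn n)" by (simp add: wn_def)
    have L': "L (Suc n) = L n + (if ?a then 1 else 0)"
      by (simp add: L_def wn_def left_shift_Suc)
    have c': "c (Suc n) = step T (c n)" by (simp add: c_def)
    have cf: "conf ?b (int (L (Suc n))) (wn (Suc n)) = c (Suc n)"
      using bs(5) Suc unfolding w' L' c' by (cases ?a) (simp_all add: add.commute)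
    have len: "length (wn (Suc n)) = length (wn n) \<and> \<not> ?a \<or> length (wn (Suc n)) = Suc (length (wn n))"
      using bs(2) unfolding w' .
    have keep: "c n j \<noteq> Cell ?b \<Longrightarrow> c (Suc n) j \<noteq> Cell ?b" for j
      unfolding c' by (rule step_not_blank[OF assms(1)])
    \<comment> \<open>This position is the left end of the word: either it has just been added and
      holds the head, or it was the left end before.\<close>
    have "c (Suc n) (- int (L (Suc n))) \<noteq> Cell ?b" if "L (Suc n) > 0"
    proof (cases ?a)
      case True
      then have "wn (Suc n) \<noteq> []" using len by auto
      then have "c (Suc n) (- int (L (Suc n))) = hd (wn (Suc n))"
        using conf_nth[of 0 "wn (Suc n)" ?b "int (L (Suc n))"] cf by (simp add: hd_conv_nth)
      then show ?thesis using bs(3)[OF True] unfolding w' by auto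
    next
      case False
      then have "L (Suc n) = L n" using L' by simp
      then show ?thesis using that Suc keep by simp
    qed
    moreover have "c (Suc n) (int (length (wn (Suc n))) - int (L (Suc n)) - 1) \<noteq> Cell ?b"
      if *: "length w + L (Suc n) < length (wn (Suc n))"
    proof (cases "\<not> ?a \<and> length (wn (Suc n)) > length (wn n)")
      case True
      then have ne: "wn (Suc n) \<noteq> []" by auto
      then have i: "int (length (wn (Suc n))) - int (L (Suc n)) - 1
          = int (length (wn (Suc n)) - 1) - int (L (Suc n))"
        by (cases "wn (Suc n)") simp_all
      have "c (Suc n) (int (length (wn (Suc n))) - int (L (Suc n)) - 1)
          = wn (Suc n) ! (length (wn (Suc n)) - 1)"
        unfolding i cf[symmetric] using ne by (intro conf_nth) simp
      also have "\<dots> = last (wn (Suc n))"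
        using ne by (rule last_conv_nth[symmetric])
      finally have "c (Suc n) (int (length (wn (Suc n))) - int (L (Suc n)) - 1) = last (wn (Suc n))" .
      then show ?thesis using bs(4) True unfolding w' by auto
    next
      case False
      \<comment> \<open>Without a new cell on the right, the length and the left offset grow by the
        same amount, so the right end keeps its position.\<close>
      then have "length (wn (Suc n)) = length (wn n) + (if ?a then 1 else 0)"
        using len by (auto split: if_splits)
      then have eq: "int (length (wn (Suc n))) - int (L (Suc n)) = int (length (wn n)) - int (L n)"
        and lt: "length w + L n < length (wn n)"
        using L' * by (auto split: if_splits)
      from lt show ?thesis using Suc keep unfolding eq by simp
    qed
    moreover have "length w + L (Suc n) \<le> length (wn (Suc n))"
      using Suc len L' by (auto split: if_splits)
    ultimately show ?case using cf bs(1) unfolding w' by simp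
  qed
  then show "heads (wn n) \<le> 1"
    and "conf (blank T) (int (L n)) (wn n) = c n"
    and "length w + L n \<le> length (wn n)"
    and "L n > 0 \<Longrightarrow> c n (- int (L n)) \<noteq> Cell (blank T)"
    and "length w + L n < length (wn n) \<Longrightarrow>
      c n (int (length (wn n)) - int (L n) - 1) \<noteq> Cell (blank T)"
    by simp_all
qed

text \<open>If one word reached further out than the other on some side, its end letter, which is
  not a plain blank, would face a default blank of the other. The bound \<open>m\<close> stands for
  the length of the initial word: a word extending past those cells on the right has an added cell
  there.\<close>

lemma conf_inject:
  assumes eq: "conf b (int k) x = conf b (int l) y"
    and len: "m + k \<le> length x" "m + l \<le> length y"
    and left: "k > 0 \<Longrightarrow> conf b (int k) x (- int k) \<noteq> Cell b"
      "l > 0 \<Longrightarrow> conf b (int l) y (- int l) \<noteq> Cell b"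
    and right: "m + k < length x \<Longrightarrow> conf b (int k) x (int (length x) - int k - 1) \<noteq> Cell b"
      "m + l < length y \<Longrightarrow> conf b (int l) y (int (length y) - int l - 1) \<noteq> Cell b"
  shows "x = y"
proof -
  have "\<not> k > l"
    using left(1) eq by (auto simp: conf_def[of b "int l" y])
  moreover have "\<not> l > k"
    using left(2) eq[symmetric] by (auto simp: conf_def[of b "int k" x])
  ultimately have kl: "k = l" by simp
  have "\<not> length x > length y"
    using right(1) eq len kl by (auto simp: conf_def[of b "int l" y])
  moreover have "\<not> length y > length x"
    using right(2) len kl unfolding eq[symmetric] by (auto simp: conf_def[of b "int l" x])
  ultimately have "length x = length y" by simp
  then show ?thesis
  proof (rule nth_equalityI)
    fix i
    assume "i < length x"
    then show "x ! i = y ! i"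
      using conf_nth[of i x b "int k"] conf_nth[of i y b "int l"] eq kl \<open>length x = length y\<close>
      by simp
  qed
qed

section \<open>Legal words\<close>

lemma strip_blanks:
  "\<exists>i v j. w = replicate i x @ v @ replicate j x \<and> (v = [] \<or> hd v \<noteq> x \<and> last v \<noteq> x)"
proof (induction "length w" arbitrary: w rule: less_induct)
  case less
  show ?case
  proof (cases "w = [] \<or> hd w \<noteq> x \<and> last w \<noteq> x")
    case True
    then show ?thesis by (intro exI[of _ 0] exI[of _ w]) simp
  next
    case ne: False
    show ?thesis
    proof (cases "hd w = x")
      case True
      then obtain v where v: "w = x # v" using ne by (cases w) auto
      then obtain i u j where "v = replicate i x @ u @ replicate j x"
          "u = [] \<or> hd u \<noteq> x \<and> last u \<noteq> x"
        using less[of v] by auto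
      with v show ?thesis by (intro exI[of _ "Suc i"] exI[of _ u] exI[of _ j]) simp
    next
      case False
      then obtain v where v: "w = v @ [x]" using ne by (cases w rule: rev_cases) auto
      then obtain i u j where "v = replicate i x @ u @ replicate j x"
          "u = [] \<or> hd u \<noteq> x \<and> last u \<noteq> x"
        using less[of v] by auto
      with v show ?thesis
        by (intro exI[of _ i] exI[of _ u] exI[of _ "Suc j"]) (simp add: replicate_append_same)
    qed
  qed
qed

lemma LegE:
  assumes "w \<in> Leg T"
  obtains i v j a y c where
    "w = replicate i (Cell (blank T)) @ v @ replicate j (Cell (blank T))"
    "v \<in> lists (Omega T)" "heads v \<le> 1" "tape v = a @ y @ c"
    "a \<in> {[], [blank T]}" "c \<in> {[], [blank T]}" "y \<in> lists (tape_alphabet T - {blank T})"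
  using assms unfolding Leg_def mem_Collect_eq by (elim exE conjE) (rule that)

lemma LegI:
  assumes "w = replicate i (Cell (blank T)) @ v @ replicate j (Cell (blank T))"
    "v \<in> lists (Omega T)" "heads v \<le> 1" "tape v = a @ y @ c"
    "a \<in> {[], [blank T]}" "y \<in> lists (tape_alphabet T - {blank T})" "c \<in> {[], [blank T]}"
  shows "w \<in> Leg T"
  unfolding Leg_def mem_Collect_eq by (rule exI conjI assms)+

text \<open>This form of legality passes to factors and applies directly to a context with a blank
  at its end. For the forward direction, a blank symbol occurs only in the padding or at an end of
  the core \<open>v\<close>. For the converse, the core is what remains after stripping plain
  blanks.\<close>

lemma Leg_iff:
  fixes T :: "('q, 'g) tm"
  assumes "turing_machine T"
  shows "w \<in> Leg T \<longleftrightarrow> w \<in> lists (Omega T) \<and> heads w \<le> 1 \<and>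
    (\<forall>t x u. w = t @ x # u \<longrightarrow> symb x = blank T \<longrightarrow>
      set t \<subseteq> {Cell (blank T)} \<or> set u \<subseteq> {Cell (blank T)})"
    (is "_ \<longleftrightarrow> ?R")
proof -
  let ?b = "blank T" and ?B = "Cell (blank T) :: ('q, 'g) letter"
  have bO: "?B \<in> Omega T" using assms by (auto simp: Omega_def turing_machine_def)
  have hB: "heads (replicate i ?B) = 0" for i by (simp add: heads_eq_0_iff)
  have "?R" if "w \<in> Leg T"
  proof -
    from that obtain i v j a y c where w: "w = replicate i ?B @ v @ replicate j ?B"
      and v1: "v \<in> lists (Omega T)" "heads v \<le> 1" and v3: "map symb v = a @ y @ c"
      and ac': "a \<in> {[], [?b]}" "c \<in> {[], [?b]}" and y: "y \<in> lists (tape_alphabet T - {?b})"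
      unfolding tape_def[symmetric] by (rule LegE)
    have ac: "length a \<le> 1" "length c \<le> 1" using ac' by auto
    note v = v1 v3
    have "set t \<subseteq> {?B} \<or> set u \<subseteq> {?B}" if d: "w = t @ x # u" "symb x = ?b" for t x u
    proof -
      let ?n = "length t"
      have t: "t = take ?n w" and u: "u = drop (Suc ?n) w" and x: "x = w ! ?n" and n: "?n < length w"
        using d by simp_all
      \<comment> \<open>The letter \<open>x\<close> is at or before the first letter of the core, at
        or after its last letter, or strictly inside it.\<close>
      consider "?n \<le> i" | "i + length v \<le> Suc ?n" | "i < ?n" "Suc ?n < i + length v" by linarith
      then show ?thesis
      proof cases
        case 1
        have "t = take ?n w" by (rule t)
        also have "\<dots> = take ?n (replicate i ?B)" using 1 by (simp add: w)
        finally have "set t \<subseteq> set (replicate i ?B)" by (metis set_take_subset)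
        then show ?thesis by auto
      next
        case 2
        have "u = drop (Suc ?n) w" by (rule u)
        also have "\<dots> = drop (Suc ?n - i - length v) (replicate j ?B)" using 2 by (simp add: w)
        finally have "set u \<subseteq> set (replicate j ?B)" by (metis set_drop_subset)
        then show ?thesis by auto
      next
        case 3
        \<comment> \<open>As \<open>a\<close> and \<open>c\<close> have length at most one, an inner
          letter of \<open>v\<close> has its symbol in \<open>y\<close>, hence not blank, which
          contradicts \<open>symb x = ?b\<close>.\<close>
        have lv: "length v = length a + length y + length c" using v(3) by (metis length_append length_map add.assoc)
        have i: "\<not> ?n < i" "?n - i < length v" using 3 by linarith+
        then have "w ! ?n = v ! (?n - i)" unfolding w by (simp add: nth_append)
        with d(2) x have "?b = map symb v ! (?n - i)" using i by simp
        also have "\<dots> = y ! (?n - i - length a)"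
        proof -
          have "\<not> ?n - i < length a" "?n - i - length a < length y" using 3 ac lv by linarith+
          then show ?thesis unfolding v(3) by (simp add: nth_append)
        qed
        also have "\<dots> \<in> set y" using 3 ac lv by (intro nth_mem) linarith
        finally show ?thesis using y by (auto simp: lists_eq_set)
      qed
    qed
    with v w bO hB show ?R by auto
  qed
  moreover have "w \<in> Leg T" if R: ?R
  proof -
    obtain i v j where w: "w = replicate i ?B @ v @ replicate j ?B"
      and v: "v = [] \<or> hd v \<noteq> ?B \<and> last v \<noteq> ?B"
      using strip_blanks[of w ?B] by (elim exE conjE)
    have vO: "v \<in> lists (Omega T)" and hv: "heads v \<le> 1" using R w by auto
    have sy: "x \<in> set v \<Longrightarrow> symb x \<in> tape_alphabet T" for x
      using vO by (auto simp: Omega_def lists_eq_set)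
    consider "v = []" | f where "v = [f]" | f m l where "v = f # m @ [l]"
      by (metis list.exhaust rev_exhaust append_Nil)
    then have "\<exists>a y c. tape v = a @ y @ c \<and> a \<in> {[], [?b]} \<and>
        y \<in> lists (tape_alphabet T - {?b}) \<and> c \<in> {[], [?b]}"
    proof cases
      case 1
      then show ?thesis by (intro exI[of _ "[]"]) (simp add: tape_def)
    next
      case 2
      show ?thesis
      proof (cases "symb f = ?b")
        case True
        with 2 show ?thesis by (intro exI[of _ "[?b]"] exI[of _ "[]"]) (simp add: tape_def)
      next
        case False
        with 2 sy show ?thesis
          by (intro exI[of _ "[]"] exI[of _ "[symb f]"]) (simp add: tape_def)
      qed
    next
      case (3 f m l)
      \<comment> \<open>A blank symbol inside the core would have \<open>f\<close> on its left and
        \<open>l\<close> on its right, and neither is a plain blank.\<close>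
      have m: "symb x \<noteq> ?b" if x: "x \<in> set m" for x
      proof
        assume b: "symb x = ?b"
        obtain m1 m2 where "m = m1 @ x # m2" using split_list[OF x] by blast
        then have "w = (replicate i ?B @ f # m1) @ x # (m2 @ l # replicate j ?B)"
          using w 3 by simp
        with b R have "set (replicate i ?B @ f # m1) \<subseteq> {?B} \<or> set (m2 @ l # replicate j ?B) \<subseteq> {?B}"
          by blast
        with v 3 show False by auto
      qed
      \<comment> \<open>The end letters are not plain blanks but may be heads on a blank; such a
        symbol goes to \<open>?a\<close> or \<open>?c\<close>, any other to
        \<open>?y\<close>.\<close>
      let ?a = "if symb f = ?b then [?b] else []" and ?c = "if symb l = ?b then [?b] else []"
      let ?y = "(if symb f = ?b then [] else [symb f]) @ map symb m @
        (if symb l = ?b then [] else [symb l])"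
      have "tape v = ?a @ ?y @ ?c" using 3 by (simp add: tape_def)
      moreover have "?y \<in> lists (tape_alphabet T - {?b})" using 3 sy m by (auto simp: lists_eq_set)
      ultimately show ?thesis by (intro exI[of _ ?a] exI[of _ ?y] exI[of _ ?c]) simp
    qed
    then show ?thesis
      by (elim exE conjE) (rule LegI[OF w vO hv])
  qed
  ultimately show ?thesis by (rule iffI)
qed

lemma Leg_heads: "turing_machine T \<Longrightarrow> w \<in> Leg T \<Longrightarrow> heads w \<le> 1"
  by (simp add: Leg_iff)

lemma Leg_blank:
  assumes "turing_machine T" "t @ x # u \<in> Leg T" "symb x = blank T"
  shows "set t \<subseteq> {Cell (blank T)} \<or> set u \<subseteq> {Cell (blank T)}"
  using assms(2,3) unfolding Leg_iff[OF assms(1)] by blast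

lemma Leg_factor:
  assumes "turing_machine T" "x @ y @ z \<in> Leg T"
  shows "y \<in> Leg T"
proof -
  let ?S = "{Cell (blank T)}"
  have "set t \<subseteq> ?S \<or> set u \<subseteq> ?S" if "y = t @ l # u" "symb l = blank T" for t l u
  proof -
    have "x @ y @ z = (x @ t) @ l # (u @ z)" using that by simp
    then have "set (x @ t) \<subseteq> ?S \<or> set (u @ z) \<subseteq> ?S"
      using Leg_blank[OF assms(1), of "x @ t" l "u @ z"] assms(2) that(2) by simp
    then show ?thesis by auto
  qed
  with assms show ?thesis unfolding Leg_iff[OF assms(1)] by auto
qed

lemma Leg_pad:
  assumes "w \<in> Leg T"
  shows "replicate m (Cell (blank T)) @ w @ replicate n (Cell (blank T)) \<in> Leg T"
proof -
  let ?b = "Cell (blank T)"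
  from assms obtain i v j a y c where w: "w = replicate i ?b @ v @ replicate j ?b"
    and v: "v \<in> lists (Omega T)" "heads v \<le> 1" "tape v = a @ y @ c"
      "a \<in> {[], [blank T]}" "c \<in> {[], [blank T]}" "y \<in> lists (tape_alphabet T - {blank T})"
    by (rule LegE)
  from w have "replicate m ?b @ w @ replicate n ?b = replicate (m + i) ?b @ v @ replicate (j + n) ?b"
    by (simp add: replicate_add)
  from this v(1,2,3,4,6,5) show ?thesis by (rule LegI)
qed

section \<open>Resets\<close>

text \<open>The index correction \<open>left_shift\<close> in \<open>cell_beta\<close> is exactly
  the offset of \<open>conf\<close>, so on the tape the observed cell stays at position
  \<open>length u\<close>.\<close>

lemma cell_beta_conf:
  assumes "turing_machine T" "u @ [X] @ v \<in> Leg T"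
  shows "cell_beta T n (u, X, v) =
    Some ((step T ^^ n) (conf (blank T) 0 (u @ [X] @ v)) (int (length u)))"
proof -
  let ?w = "u @ [X] @ v"
  have h: "heads ?w \<le> 1" using assms by (rule Leg_heads)
  have "length u + left_shift T n ?w < length ((beta T ^^ n) ?w)"
    using run_conf(3)[OF assms(1) h, of n] by simp
  from conf_nth[OF this, of "blank T" "int (left_shift T n ?w)"] run_conf(2)[OF assms(1) h, of n] assms(2)
  show ?thesis by (simp add: cell_beta_def Let_def)
qed

text \<open>The run is that of the unpadded \<open>w\<close>, so one configuration sequence
  describes all choices of \<open>X\<close>, including cells outside \<open>w\<close>.\<close>

lemma cell_beta_pad_conf:
  assumes "turing_machine T" "u @ [X] @ v \<in> Leg T"
    "u @ [X] @ v = replicate m (Cell (blank T)) @ w @ replicate k (Cell (blank T))"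
  shows "cell_beta T n (u, X, v) =
    Some ((step T ^^ n) (conf (blank T) 0 w) (int (length u) - int m))"
proof -
  let ?b = "blank T" and ?w = "u @ [X] @ v"
  have "conf ?b 0 ?w = (\<lambda>j. conf ?b (0 + int m) ?w (j + - int m))"
    by (rule ext) (simp add: conf_def)
  also have "\<dots> = (\<lambda>j. conf ?b 0 w (j + - int m))"
    unfolding assms(3) conf_pad ..
  finally have "(step T ^^ n) (conf ?b 0 ?w) = (\<lambda>j. (step T ^^ n) (conf ?b 0 w) (j + - int m))"
    by (simp only: step_shift)
  then show ?thesis using cell_beta_conf[OF assms(1,2)] by simp
qed

lemma cell_beta_blanks:
  assumes T: "turing_machine T" and l: "s @ u @ [X] @ v @ t \<in> Leg T"
    and s: "set s \<subseteq> {Cell (blank T)}" and t: "set t \<subseteq> {Cell (blank T)}"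
  shows "cell_beta T n (s @ u, X, v @ t) = cell_beta T n (u, X, v)"
proof -
  let ?b = "Cell (blank T)"
  obtain m k where *: "s = replicate m ?b" "t = replicate k ?b"
    using that[OF replicate_length_same[symmetric] replicate_length_same[symmetric]] s t by blast
  have l': "u @ [X] @ v \<in> Leg T"
    using Leg_factor[OF T, of s "u @ [X] @ v" t] l by simp
  have "(s @ u) @ [X] @ (v @ t) =
      replicate m ?b @ (u @ [X] @ v) @ replicate k ?b"
    using * by simp
  from cell_beta_pad_conf[OF T _ this, of n] have "cell_beta T n (s @ u, X, v @ t) =
      Some ((step T ^^ n) (conf (blank T) 0 (u @ [X] @ v)) (int (length (s @ u)) - int m))"
    using l by simp
  moreover have "int (length (s @ u)) - int m = int (length u)" using * by simp
  ultimately show ?thesis using cell_beta_conf[OF T l'] by simp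
qed

lemma blank_start_RRes:
  assumes T: "turing_machine T" and r: "r \<in> lists (Omega T)" "r \<noteq> []"
    "hd r = Cell (blank T)" "\<not> set r \<subseteq> {Cell (blank T)}"
  shows "r \<in> RRes T"
proof -
  let ?b = "Cell (blank T)"
  obtain s where s: "r = ?b # s" "\<not> set s \<subseteq> {?b}" using r by (cases r) auto
  have eq: "cell_beta T n (t1 @ r @ t2, X, t3) = cell_beta T n (r @ t2, X, t3)"
    if "t1 @ r @ t2 @ [X] @ t3 \<in> Leg T" for n t1 t2 t3 X
  proof -
    have "t1 @ r @ t2 @ [X] @ t3 = t1 @ ?b # (s @ t2 @ [X] @ t3)" using s by simp
    with that have "set t1 \<subseteq> {?b} \<or> set (s @ t2 @ [X] @ t3) \<subseteq> {?b}"
      by (intro Leg_blank[OF T, of _ ?b]) simp_all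
    then have "set t1 \<subseteq> {?b}" using s by auto
    then show ?thesis
      using cell_beta_blanks[OF T, of t1 "r @ t2" X t3 "[]"] that by simp
  qed
  show ?thesis unfolding RRes_def using r(1) eq by auto
qed

lemma blank_end_LRes:
  assumes T: "turing_machine T" and r: "r \<in> lists (Omega T)" "r \<noteq> []"
    "last r = Cell (blank T)" "\<not> set r \<subseteq> {Cell (blank T)}"
  shows "r \<in> LRes T"
proof -
  let ?b = "Cell (blank T)"
  obtain s where s: "r = s @ [?b]" "\<not> set s \<subseteq> {?b}" using r by (cases r rule: rev_cases) auto
  have eq: "cell_beta T n (t1, X, t2 @ r @ t3) = cell_beta T n (t1, X, t2 @ r)"
    if "t1 @ [X] @ t2 @ r @ t3 \<in> Leg T" for n t1 t2 t3 X
  proof -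
    have "t1 @ [X] @ t2 @ r @ t3 = (t1 @ [X] @ t2 @ s) @ ?b # t3" using s by simp
    with that have "set (t1 @ [X] @ t2 @ s) \<subseteq> {?b} \<or> set t3 \<subseteq> {?b}"
      by (intro Leg_blank[OF T, of _ ?b]) simp_all
    then have "set t3 \<subseteq> {?b}" using s by auto
    then show ?thesis
      using cell_beta_blanks[OF T, of "[]" t1 X "t2 @ r" t3] that by simp
  qed
  show ?thesis unfolding LRes_def using r(1) eq by auto
qed

section \<open>Shortening contexts by minimal resets\<close>

lemma RResD:
  assumes "r \<in> RRes T" "t1 \<in> lists (Omega T)" "t1' \<in> lists (Omega T)" "t2 \<in> lists (Omega T)"
    "t3 \<in> lists (Omega T)" "X \<in> Omega T"
    "t1 @ r @ t2 @ [X] @ t3 \<in> Leg T" "t1' @ r @ t2 @ [X] @ t3 \<in> Leg T"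
  shows "cell_beta T n (t1 @ r @ t2, X, t3) = cell_beta T n (t1' @ r @ t2, X, t3)"
  using assms(1)[unfolded RRes_def mem_Collect_eq] assms(2-) by meson

lemma LResD:
  assumes "r \<in> LRes T" "t1 \<in> lists (Omega T)" "t2 \<in> lists (Omega T)" "t3 \<in> lists (Omega T)"
    "t3' \<in> lists (Omega T)" "X \<in> Omega T"
    "t1 @ [X] @ t2 @ r @ t3 \<in> Leg T" "t1 @ [X] @ t2 @ r @ t3' \<in> Leg T"
  shows "cell_beta T n (t1, X, t2 @ r @ t3) = cell_beta T n (t1, X, t2 @ r @ t3')"
  using assms(1)[unfolded LRes_def mem_Collect_eq] assms(2-) by meson

lemma RRes_suffix:
  assumes T: "turing_machine T" and "r \<in> RRes T" "suffix r u" "u @ [X] @ v \<in> Leg T"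
  shows "cell_beta T n (u, X, v) = cell_beta T n (r, X, v)"
proof -
  obtain t where t: "u = t @ r" using assms(3) by (auto simp: suffix_def)
  have l: "r @ [X] @ v \<in> Leg T" using Leg_factor[OF T, of t "r @ [X] @ v" "[]"] assms t by simp
  have "u @ [X] @ v \<in> lists (Omega T)" using assms(4) unfolding Leg_iff[OF T] by (elim conjE)
  then have "t \<in> lists (Omega T)" "v \<in> lists (Omega T)" "X \<in> Omega T" using t by simp_all
  \<comment> \<open>The reset property is applied with the empty word as second left context and as
    \<open>t2\<close>.\<close>
  then have "cell_beta T n (t @ r @ [], X, v) = cell_beta T n ([] @ r @ [], X, v)"
    using assms(2,4) l t by (intro RResD[of r T]) simp_all
  then show ?thesis using t by simp
qed

lemma LRes_prefix:
  assumes T: "turing_machine T" and "r \<in> LRes T" "prefix r v" "u @ [X] @ v \<in> Leg T"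
  shows "cell_beta T n (u, X, v) = cell_beta T n (u, X, r)"
proof -
  obtain t where t: "v = r @ t" using assms(3) by (auto simp: prefix_def)
  have l: "u @ [X] @ r \<in> Leg T" using Leg_factor[OF T, of "[]" "u @ [X] @ r" t] assms t by simp
  have "u @ [X] @ v \<in> lists (Omega T)" using assms(4) unfolding Leg_iff[OF T] by (elim conjE)
  then have "t \<in> lists (Omega T)" "u \<in> lists (Omega T)" "X \<in> Omega T" using t by simp_all
  then have "cell_beta T n (u, X, [] @ r @ t) = cell_beta T n (u, X, [] @ r @ [])"
    using assms(2,4) l t by (intro LResD[of r T]) simp_all
  then show ?thesis using t by simp
qed

text \<open>A shortest suffix of \<open>u\<close> in \<open>RRes T\<close> is minimal, since a
  suffix of it that is no shorter equals it.\<close>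

lemma RSC_suffix:
  assumes "u \<in> RRes T"
  obtains r where "r \<in> RSC T" "suffix r u"
proof -
  obtain r where r: "r \<in> RRes T" "suffix r u"
    and min: "\<And>s. s \<in> RRes T \<Longrightarrow> suffix s u \<Longrightarrow> length r \<le> length s"
    using ex_has_least_nat[of "\<lambda>s. s \<in> RRes T \<and> suffix s u" u length] assms by auto
  have "s = r" if "s \<in> RRes T" "suffix s r" for s
    using min[OF that(1) suffix_order.trans[OF that(2) r(2)]] that(2) by (auto simp: suffix_def)
  with r show ?thesis by (intro that[of r]) (auto simp: RSC_def)
qed

lemma LSC_prefix:
  assumes "u \<in> LRes T"
  obtains r where "r \<in> LSC T" "prefix r u"
proof -
  obtain r where r: "r \<in> LRes T" "prefix r u"
    and min: "\<And>s. s \<in> LRes T \<Longrightarrow> prefix s u \<Longrightarrow> length r \<le> length s"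
    using ex_has_least_nat[of "\<lambda>s. s \<in> LRes T \<and> prefix s u" u length] assms by auto
  have "s = r" if "s \<in> LRes T" "prefix s r" for s
    using min[OF that(1) prefix_order.trans[OF that(2) r(2)]] that(2) by (auto simp: prefix_def)
  with r show ?thesis by (intro that[of r]) (auto simp: LSC_def)
qed

text \<open>If the empty word is a right reset of one of the machines, the hypothesis alone does not say
  that it is one of the other; a common element is then found through a suffix of \<open>u\<close>.\<close>

lemma common_RSC_suffix:
  assumes eq: "RSC T \<union> {[]} = RSC T' \<union> {[]}" and "u \<in> RRes T" "u \<in> RRes T'"
  obtains r where "r \<in> RSC T" "r \<in> RSC T'" "suffix r u"
proof -
  obtain r r' where *: "r \<in> RSC T" "suffix r u" "r' \<in> RSC T'" "suffix r' u"
    using RSC_suffix assms(2,3) by metis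
  show ?thesis
  proof (cases "r = []")
    case True
    then have "[] \<in> RRes T" using * by (simp add: RSC_def)
    \<comment> \<open>The empty word is a suffix of every word, so as a right reset it is the only
      minimal one; by \<open>eq\<close>, \<open>r'\<close> is then empty too.\<close>
    then have "x = []" if "x \<in> RSC T" for x using that by (auto simp: RSC_def)
    then have "r' = []" using eq *(3) by auto
    with True * show ?thesis by (intro that[of r]) auto
  next
    case False
    with * eq show ?thesis by (intro that[of r]) auto
  qed
qed

lemma common_LSC_prefix:
  assumes eq: "LSC T \<union> {[]} = LSC T' \<union> {[]}" and "u \<in> LRes T" "u \<in> LRes T'"
  obtains r where "r \<in> LSC T" "r \<in> LSC T'" "prefix r u"
proof -
  obtain r r' where *: "r \<in> LSC T" "prefix r u" "r' \<in> LSC T'" "prefix r' u"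
    using LSC_prefix assms(2,3) by metis
  show ?thesis
  proof (cases "r = []")
    case True
    then have "[] \<in> LRes T" using * by (simp add: LSC_def)
    then have "x = []" if "x \<in> LSC T" for x using that by (auto simp: LSC_def)
    then have "r' = []" using eq *(3) by auto
    with True * show ?thesis by (intro that[of r]) auto
  next
    case False
    with * eq show ?thesis by (intro that[of r]) auto
  qed
qed

lemma output_source_eqD:
  assumes "output_source T = output_source T'" "turing_machine T"
  shows "RSC T \<union> {[]} = RSC T' \<union> {[]}" "LSC T \<union> {[]} = LSC T' \<union> {[]}"
proof -
  \<comment> \<open>Cancelling factors in an equation of products requires them to be nonempty; the
    blank witnesses this for \<open>Omega T\<close>.\<close>
  have bO: "Cell (blank T) \<in> Omega T" using assms(2) by (auto simp: Omega_def turing_machine_def)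
  then show "RSC T \<union> {[]} = RSC T' \<union> {[]}" "LSC T \<union> {[]} = LSC T' \<union> {[]}"
    using assms(1) unfolding output_source_def by (auto simp: times_eq_iff)
qed

section \<open>Limits and the output function\<close>

lemma eventual_valueI:
  assumes "\<forall>\<^sub>F n in sequentially. f n = x"
  shows "eventual_value f = x"
  unfolding eventual_value_def
proof (rule the_equality)
  fix y
  assume "\<forall>\<^sub>F n in sequentially. f n = y"
  with assms have "\<forall>\<^sub>F n in sequentially. x = y" by eventually_elim simp
  then show "y = x" by simp
qed (rule assms)

lemma adds_left_length: "adds_left T w \<Longrightarrow> length (beta T w) = Suc (length w)"
  by (auto simp: adds_left_def beta_def)

text \<open>Besides the word, its offset must become stable. The limit word is a fixed point of
  \<open>beta\<close>, while a move that adds a cell on the left lengthens the word, so no such move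
  occurs any more.\<close>

lemma halting_run:
  assumes "legal_halting T" "w \<in> Leg T"
  obtains N where "\<And>n. n \<ge> N \<Longrightarrow> (beta T ^^ n) w = (beta T ^^ N) w"
    and "\<And>n. n \<ge> N \<Longrightarrow> left_shift T n w = left_shift T N w"
proof -
  obtain x N where N: "\<And>n. n \<ge> N \<Longrightarrow> (beta T ^^ n) w = x"
    using assms unfolding legal_halting_def eventually_sequentially by meson
  have "beta T ((beta T ^^ N) w) = x" using N[of "Suc N"] by simp
  then have "beta T x = x" unfolding N[OF order_refl] .
  then have x: "\<not> adds_left T x" using adds_left_length[of T x] by auto
  have "left_shift T n w = left_shift T N w" if "n \<ge> N" for n
    using that
  proof (induction n rule: dec_induct)
    case (step n)
    have "\<not> adds_left T ((beta T ^^ n) w)" unfolding N[OF step(1)] by (rule x)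
    then show ?case unfolding left_shift_Suc step(3) by (simp only: if_False add_0_right)
  qed simp
  moreover have "(beta T ^^ n) w = (beta T ^^ N) w" if "n \<ge> N" for n
    unfolding N[OF that] N[OF order_refl] ..
  ultimately show ?thesis by (intro that[of N])
qed

text \<open>The left context is shortened first, then the right one, each to the empty word if it is
  all blanks and otherwise to a minimal reset common to both machines. Thus one triple serves
  \<open>T\<close> and \<open>T'\<close> for every \<open>n\<close>.\<close>

lemma cell_beta_output:
  fixes T T' :: "('q, 'g) tm"
  assumes T: "turing_machine T" "turing_machine T'"
    and sync: "states T = states T'" "tape_alphabet T = tape_alphabet T'" "blank T = blank T'"
    and src: "output_source T = output_source T'"
    and l: "u @ [X] @ v \<in> Leg T"
    and u: "u = [] \<or> hd u = Cell (blank T)" and v: "v = [] \<or> last v = Cell (blank T)"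
  obtains r s where "(r, X, s) \<in> output_source T" "r @ [X] @ s \<in> Leg T"
    "\<And>n. cell_beta T n (u, X, v) = cell_beta T n (r, X, s)"
    "\<And>n. cell_beta T' n (u, X, v) = cell_beta T' n (r, X, s)"
proof -
  let ?b = "Cell (blank T)"
  have Om: "Omega T' = Omega T" using sync by (simp add: Omega_def)
  have Le: "Leg T' = Leg T" using sync by (simp add: Leg_def Om)
  have uO: "u \<in> lists (Omega T)" and vO: "v \<in> lists (Omega T)" and XO: "X \<in> Omega T"
    using l[unfolded Leg_iff[OF T(1)], THEN conjunct1] by simp_all
  obtain r where r: "r \<in> RSC T \<union> {[]}" "suffix r u"
    "\<And>n. cell_beta T n (u, X, v) = cell_beta T n (r, X, v)"
    "\<And>n. cell_beta T' n (u, X, v) = cell_beta T' n (r, X, v)"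
  proof (cases "set u \<subseteq> {?b}")
    case True
    with that[of "[]"] l Le sync show ?thesis
      using cell_beta_blanks[OF T(1), of u "[]" X v "[]"] cell_beta_blanks[OF T(2), of u "[]" X v "[]"]
      by simp
  next
    case False
    then have ne: "u \<noteq> []" by auto
    have "u \<in> RRes T" "u \<in> RRes T'"
      using blank_start_RRes[OF T(1) uO] blank_start_RRes[OF T(2), of u] uO Om u False ne sync by auto
    with common_RSC_suffix output_source_eqD(1)[OF src T(1)]
    obtain r where "r \<in> RSC T" "r \<in> RSC T'" "suffix r u" by metis
    then show ?thesis
      using that[of r] RRes_suffix[OF T(1), of r u X v] RRes_suffix[OF T(2), of r u X v] l Le
      by (auto simp: RSC_def)
  qed
  obtain t where "u = t @ r" using r(2) by (auto simp: suffix_def)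
  \<comment> \<open>The right context is shortened next to the already shortened \<open>r\<close>,
    so legality is needed for this smaller word.\<close>
  then have l1: "r @ [X] @ v \<in> Leg T" using Leg_factor[OF T(1), of t "r @ [X] @ v" "[]"] l by simp
  obtain s where s: "s \<in> LSC T \<union> {[]}" "prefix s v"
    "\<And>n. cell_beta T n (r, X, v) = cell_beta T n (r, X, s)"
    "\<And>n. cell_beta T' n (r, X, v) = cell_beta T' n (r, X, s)"
  proof (cases "set v \<subseteq> {?b}")
    case True
    with that[of "[]"] l1 Le sync show ?thesis
      using cell_beta_blanks[OF T(1), of "[]" r X "[]" v] cell_beta_blanks[OF T(2), of "[]" r X "[]" v]
      by simp
  next
    case False
    then have ne: "v \<noteq> []" by auto
    have "v \<in> LRes T" "v \<in> LRes T'"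
      using blank_end_LRes[OF T(1) vO] blank_end_LRes[OF T(2), of v] vO Om v False ne sync by auto
    with common_LSC_prefix output_source_eqD(2)[OF src T(1)]
    obtain s where "s \<in> LSC T" "s \<in> LSC T'" "prefix s v" by metis
    then show ?thesis
      using that[of s] LRes_prefix[OF T(1), of s v r X] LRes_prefix[OF T(2), of s v r X] l1 Le
      by (auto simp: LSC_def)
  qed
  obtain t' where "v = s @ t'" using s(2) by (auto simp: prefix_def)
  then have "r @ [X] @ s \<in> Leg T" using Leg_factor[OF T(1), of "[]" "r @ [X] @ s" t'] l1 by simp
  moreover have "(r, X, s) \<in> output_source T" using r(1) s(1) XO by (auto simp: output_source_def)
  ultimately show ?thesis using r(3,4) s(3,4) by (intro that[of r s]) simp_all
qed

theorem proposition2p4: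
  fixes T T' :: "('q, 'g) tm"
  assumes "turing_machine T" and "turing_machine T'"
    and "legal_halting T" and "legal_halting T'"
    and "states T = states T'"
    and "tape_alphabet T = tape_alphabet T'"
    and "blank T = blank T'"
    and "output_function T = output_function T'"
  shows "\<forall>w \<in> Leg T. beta_omega T w = beta_omega T' w"
proof
  fix w
  assume w: "w \<in> Leg T"
  let ?b = "blank T" and ?c = "conf (blank T) 0 w"
  have Le: "Leg T' = Leg T" using assms(5-7) by (simp add: Leg_def Omega_def)
  have src: "output_source T = output_source T'"
    and out: "cell_beta_omega T |` output_source T = cell_beta_omega T' |` output_source T'"
    using assms(8) unfolding output_function_def prod.inject by blast+
  obtain N where N: "\<And>n. n \<ge> N \<Longrightarrow> (beta T ^^ n) w = (beta T ^^ N) w"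
      "\<And>n. n \<ge> N \<Longrightarrow> left_shift T n w = left_shift T N w"
    using halting_run[OF assms(3) w] by blast
  obtain N' where N': "\<And>n. n \<ge> N' \<Longrightarrow> (beta T' ^^ n) w = (beta T' ^^ N') w"
      "\<And>n. n \<ge> N' \<Longrightarrow> left_shift T' n w = left_shift T' N' w"
    using halting_run[OF assms(4)] w Le by blast
  have h: "heads w \<le> 1" using assms(1) w by (rule Leg_heads)
  note run = run_conf[OF assms(1) h, of N] and run' = run_conf[OF assms(2) h, of N']
  have d: "(step T ^^ n) ?c = (step T ^^ N) ?c" if "n \<ge> N" for n
    using run(2) run_conf(2)[OF assms(1) h, of n] N[OF that] by simp
  have d': "(step T' ^^ n) ?c = (step T' ^^ N') ?c" if "n \<ge> N'" for n
    using run'(2) run_conf(2)[OF assms(2) h, of n] N'[OF that] assms(7) by simp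
  \<comment> \<open>The halted configurations are compared at every position, also outside
    \<open>w\<close>, where cells may have been added.\<close>
  have "(step T ^^ N) ?c = (step T' ^^ N') ?c"
  proof
    fix j :: int
    \<comment> \<open>The margin puts cell \<open>j\<close> inside the padded word \<open>W\<close>,
      at index \<open>j + int m\<close>; being positive, it makes \<open>W\<close> begin and end
      with a blank.\<close>
    define m where "m = Suc (nat \<bar>j\<bar>)"
    have m: "m \<noteq> 0" "- int m < j" "j < int m" unfolding m_def by linarith+
    define W where "W = replicate m (Cell ?b) @ w @ replicate m (Cell ?b)"
    define i where "i = nat (j + int m)"
    have ij: "int i = j + int m" using m unfolding i_def by linarith
    let ?u = "take i W" and ?X = "W ! i" and ?v = "drop (Suc i) W"
    have i: "i < length W" using m ij unfolding W_def by simp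
    have split: "?u @ [?X] @ ?v = replicate m (Cell ?b) @ w @ replicate m (Cell ?b)"
      using id_take_nth_drop[OF i] unfolding W_def by simp
    have l: "?u @ [?X] @ ?v \<in> Leg T" unfolding split using w by (rule Leg_pad)
    have lu: "int (length ?u) - int m = j" using i ij by simp
    have hl: "hd W = Cell ?b" "last W = Cell ?b" using m(1) by (simp_all add: W_def)
    \<comment> \<open>A nonempty left context inherits the first letter of \<open>W\<close>;
      likewise, a nonempty right context inherits the last.\<close>
    have u: "?u = [] \<or> hd ?u = Cell ?b"
      using hd_take[of i W] hl(1) by (cases "i = 0") simp_all
    have v: "?v = [] \<or> last ?v = Cell ?b"
      using last_drop[of "Suc i" W] hl(2) by (cases "Suc i < length W") simp_all
    obtain r s where rs: "(r, ?X, s) \<in> output_source T" "r @ [?X] @ s \<in> Leg T"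
      "\<And>n. cell_beta T n (?u, ?X, ?v) = cell_beta T n (r, ?X, s)"
      "\<And>n. cell_beta T' n (?u, ?X, ?v) = cell_beta T' n (r, ?X, s)"
      using cell_beta_output[OF assms(1,2,5-7) src l u v] by blast
    have e: "cell_beta T n (r, ?X, s) = Some ((step T ^^ n) ?c j)" for n
      using cell_beta_pad_conf[OF assms(1) l split, of n] rs(3)[of n] lu by simp
    have e': "cell_beta T' n (r, ?X, s) = Some ((step T' ^^ n) ?c j)" for n
      using cell_beta_pad_conf[OF assms(2), of ?u ?X ?v m w m n] l split rs(4)[of n] lu
      unfolding Le assms(7)[symmetric] by simp
    have "cell_beta_omega T (r, ?X, s) = Some ((step T ^^ N) ?c j)"
    proof -
      have "eventual_value (\<lambda>n. cell_beta T n (r, ?X, s)) = Some ((step T ^^ N) ?c j)"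
        by (rule eventual_valueI, rule eventually_sequentiallyI[of N]) (subst e, subst d, simp_all)
      then show ?thesis using rs(2) by (simp add: cell_beta_omega_def)
    qed
    moreover have "cell_beta_omega T' (r, ?X, s) = Some ((step T' ^^ N') ?c j)"
    proof -
      have "eventual_value (\<lambda>n. cell_beta T' n (r, ?X, s)) = Some ((step T' ^^ N') ?c j)"
        by (rule eventual_valueI, rule eventually_sequentiallyI[of N']) (subst e', subst d', simp_all)
      then show ?thesis using rs(2) Le by (simp add: cell_beta_omega_def)
    qed
    \<comment> \<open>The triple lies in the common source set, so equality of the restricted maps
      gives equality of the values.\<close>
    moreover have "cell_beta_omega T (r, ?X, s) = cell_beta_omega T' (r, ?X, s)"
      using fun_cong[OF out, of "(r, ?X, s)"] rs(1) src by simp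
    ultimately show "(step T ^^ N) ?c j = (step T' ^^ N') ?c j" by simp
  qed
  \<comment> \<open>Equal configurations give equal words, because by \<open>run_conf\<close> both
    cover the cells of \<open>w\<close> and neither has a plain blank as an outermost added
    cell.\<close>
  then have "(beta T ^^ N) w = (beta T' ^^ N') w"
    using run(2-) run'(2-) unfolding assms(7)[symmetric]
    by (intro conf_inject[of ?b "left_shift T N w" _ "left_shift T' N' w" _ "length w"]) simp_all
  moreover have "beta_omega T w = (beta T ^^ N) w" "beta_omega T' w = (beta T' ^^ N') w"
    unfolding beta_omega_def
    by (rule eventual_valueI, rule eventually_sequentiallyI, erule N(1))
      (rule eventual_valueI, rule eventually_sequentiallyI, erule N'(1))
  ultimately show "beta_omega T w = beta_omega T' w" by simp
qed

end
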